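(* Let $w\in\mathbb{C}$ with $\operatorname{Re}(w)>-1$ and let $z\in\mathbb{C}$ with $z\notin\mathbb{Z}$. Then the following series converges absolutely and $$\sum_{k=0}^{\infty}\binom{w}{k}\frac{\cos(\pi z-\pi k)}{\pi z-\pi k}=\binom{w}{z}\cot(\pi z).$$
   Context: For $w\in\mathbb{C}$ not a negative integer and $z\in\mathbb{C}$, the generalized binomial coefficient is $\binom{w}{z}=\frac{\Gamma(w+1)}{\Gamma(z+1)\Gamma(w-z+1)}$, where the reciprocal gamma function $1/\Gamma$ is understood as an entire function (equal to $0$ at the nonpositive integers). For an integer $k\ge 1$ one has $\binom{w}{k}=\frac{w(w-1)\cdots(w-k+1)}{k!}$, and $\binom{w}{0}=1$. *)

theory Defs
  imports "HOL-Analysis.Analysis"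
begin

text \<open>
  The value is meaningful when \<open>w\<close> is not a negative integer (elsewhere the library sets
  \<open>Gamma (w + 1) = 0\<close>).  \<open>rGamma\<close> is the entire reciprocal gamma function.
\<close>

definition cbinom :: "complex \<Rightarrow> complex \<Rightarrow> complex" where
  "cbinom w z = Gamma (w + 1) * rGamma (z + 1) * rGamma (w - z + 1)"

lemma cbinom_of_nat:
  assumes "w + 1 \<notin> \<int>\<^sub>\<le>\<^sub>0"
  shows "cbinom w (of_nat k) = w gchoose k"
  using assms
  by (simp add: cbinom_def gbinomial_Gamma rGamma_inverse_Gamma Gamma_fact[symmetric] add.commute field_simps)

end

(*
  Since cos (pi z - pi k) = (-1)^k cos (pi z), the series is a multiple of
  sum_k (-1)^k (w choose k) / (z - k), which up to the factor 1/z is the hypergeometric series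
  F(-w, -z; 1 - z; 1).  Gauss's summation theorem evaluates it, and the reflection formula turns
  the result into the right-hand side.

  Gauss's theorem: a telescoping sum gives
  (c - a - b) F(a, b; c; 1) = (c - a) (c - b) / c * F(a, b; c + 1; 1).
  Iterating this shifts c to c + m; as m tends to infinity, F(a, b; c + m; 1) tends to 1 by
  dominated convergence, and the product of the factors converges to a quotient of Gamma values.
*)
theory Submission
  imports Defs
begin

section \<open>Gauss's summation theorem\<close>

text \<open>The n-th term of Gauss's hypergeometric series F(a, b; c; x) at x = 1.\<close>

definition hyp_term :: "complex \<Rightarrow> complex \<Rightarrow> complex \<Rightarrow> nat \<Rightarrow> complex" where
  "hyp_term a b c n = pochhammer a n * pochhammer b n / (pochhammer c n * fact n)"

lemma hyp_term_0 [simp]: "hyp_term a b c 0 = 1"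
  by (simp add: hyp_term_def)

lemma hyp_term_Suc:
  "hyp_term a b c (Suc n) =
     hyp_term a b c n * ((a + of_nat n) * (b + of_nat n) / ((c + of_nat n) * of_nat (Suc n)))"
  by (simp add: hyp_term_def pochhammer_rec' field_simps del: of_nat_Suc)

lemma plus_of_nat_not_nonpos_Ints:
  fixes c :: complex
  assumes "c \<notin> \<int>\<^sub>\<le>\<^sub>0"
  shows "c + of_nat n \<notin> \<int>\<^sub>\<le>\<^sub>0"
  using assms nonpos_Ints_diff_Nats[of "c + of_nat n" "of_nat n"] by auto

lemma plus_of_nat_nonzero:
  fixes c :: complex
  assumes "c \<notin> \<int>\<^sub>\<le>\<^sub>0"
  shows "c + of_nat n \<noteq> 0"
  using plus_of_nat_not_nonpos_Ints[OF assms, of n] by auto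

section \<open>Growth of the terms and absolute convergence\<close>

lemma pochhammer_conv_rGamma_series:
  fixes a :: complex
  shows "pochhammer a (Suc n) = rGamma_series a n * fact n * exp (a * of_real (ln (of_nat n)))"
  by (simp add: rGamma_series_def)

text \<open>Since \<open>rGamma_series\<close> converges to \<open>rGamma\<close>, this splits the
  term into a convergent factor and the power n^(a+b-c). Multiplying by \<open>Suc n\<close> reduces
  \<open>fact (Suc n)\<close> to \<open>fact n\<close>, after which all factorials cancel.\<close>

lemma Suc_times_hyp_term_Suc:
  "of_nat (Suc n) * hyp_term a b c (Suc n) =
     rGamma_series a n * rGamma_series b n / rGamma_series c n *
     exp ((a + b - c) * of_real (ln (of_nat n)))"
  unfolding hyp_term_def pochhammer_conv_rGamma_series
  by (simp add: exp_add exp_diff ring_distribs divide_simps del: of_nat_Suc)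

lemma hyp_coeff_tendsto:
  fixes a b c :: complex
  assumes "c \<notin> \<int>\<^sub>\<le>\<^sub>0"
  shows "(\<lambda>n. rGamma_series a n * rGamma_series b n / rGamma_series c n)
           \<longlonglongrightarrow> rGamma a * rGamma b / rGamma c"
  using assms by (intro tendsto_intros) (simp add: rGamma_eq_zero_iff)

lemma norm_exp_mult_ln:
  assumes "n > 0"
  shows "norm (exp (s * complex_of_real (ln (of_nat n)))) = of_nat n powr Re s"
  using assms by (simp add: powr_def)

text \<open>The power n^(a+b-c) decays because its exponent has negative real part. This is the
  boundary term at infinity of the telescoping sum below.\<close>

lemma of_nat_times_hyp_term_tendsto_0:
  assumes "c \<notin> \<int>\<^sub>\<le>\<^sub>0" and "Re (c - a - b) > 0"
  shows "(\<lambda>n. of_nat n * hyp_term a b c n) \<longlonglongrightarrow> 0"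
proof -
  have "((\<lambda>n. real n powr Re (a + b - c)) \<longlongrightarrow> 0) sequentially"
    using assms(2) by (intro tendsto_neg_powr filterlim_real_sequentially) auto
  then have "(\<lambda>n. norm (exp ((a + b - c) * complex_of_real (ln (of_nat n))))) \<longlonglongrightarrow> 0"
    by (rule Lim_transform_eventually)
      (use eventually_gt_at_top[of 0] in \<open>eventually_elim, simp only: norm_exp_mult_ln\<close>)
  then have "(\<lambda>n. exp ((a + b - c) * complex_of_real (ln (of_nat n)))) \<longlonglongrightarrow> 0"
    by (simp only: tendsto_norm_zero_iff)
  from tendsto_mult[OF hyp_coeff_tendsto[OF assms(1), of a b] this]
  have "(\<lambda>n. of_nat (Suc n) * hyp_term a b c (Suc n)) \<longlonglongrightarrow> 0"
    unfolding Suc_times_hyp_term_Suc by simp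
  then show ?thesis
    by (rule LIMSEQ_imp_Suc)
qed

text \<open>The terms are O(n^(s-1)) with s = Re (a+b-c) < 0, so a convergent p-series dominates
  them.\<close>

lemma summable_norm_hyp_term:
  assumes "c \<notin> \<int>\<^sub>\<le>\<^sub>0" and "Re (c - a - b) > 0"
  shows "summable (\<lambda>n. norm (hyp_term a b c n))"
proof -
  let ?q = "\<lambda>n. rGamma_series a n * rGamma_series b n / rGamma_series c n"
  define s where "s = Re (a + b - c)"
  have "Bseq ?q"
    using hyp_coeff_tendsto[OF assms(1)] convergent_def convergent_imp_Bseq by blast
  then obtain K where K: "norm (?q n) \<le> K" for n
    by (meson BseqE)
  have bound: "norm (norm (hyp_term a b c (Suc n))) \<le> K * real n powr (s - 1)" if "n > 0" for n
  proof -
    have "real n * norm (hyp_term a b c (Suc n)) \<le> norm (of_nat (Suc n) * hyp_term a b c (Suc n))"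
      by (simp add: norm_mult mult_right_mono del: of_nat_Suc)
    also have "\<dots> = norm (?q n) * real n powr s"
      unfolding Suc_times_hyp_term_Suc norm_mult s_def
      using that by (simp only: norm_exp_mult_ln)
    also have "\<dots> \<le> K * real n powr s"
      by (intro mult_right_mono K) auto
    finally show ?thesis
      using that by (simp add: powr_diff field_simps)
  qed
  have "\<forall>\<^sub>F n in sequentially. norm (norm (hyp_term a b c (Suc n))) \<le> K * real n powr (s - 1)"
    using eventually_gt_at_top[of 0] by eventually_elim (rule bound)
  moreover have "summable (\<lambda>n. K * real n powr (s - 1))"
    using assms(2) by (intro summable_mult) (simp add: summable_real_powr_iff s_def)
  ultimately have "summable (\<lambda>n. norm (hyp_term a b c (Suc n)))"
    by (rule summable_comparison_test_ev)
  then show ?thesis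
    using summable_Suc_iff[of "\<lambda>n. norm (hyp_term a b c n)"] by blast
qed

section \<open>Contiguous relation between c and c + 1\<close>

lemma hyp_term_shift:
  assumes "c \<notin> \<int>\<^sub>\<le>\<^sub>0"
  shows "hyp_term a b (c + 1) n = hyp_term a b c n * (c / (c + of_nat n))"
proof -
  \<comment> \<open>Both sides equal \<open>pochhammer c (Suc n)\<close>, with the first or the last
    factor split off.\<close>
  have "c * pochhammer (c + 1) n = (c + of_nat n) * pochhammer c n"
    by (metis pochhammer_rec pochhammer_rec')
  moreover have "c \<noteq> 0"
    using assms by auto
  ultimately have "pochhammer (c + 1) n = (c + of_nat n) * pochhammer c n / c"
    by (simp add: field_simps)
  then show ?thesis
    by (simp add: hyp_term_def mult_ac)
qed

text \<open>Every summand is a multiple of \<open>hyp_term a b c n\<close>. With that factor removed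
  and denominators cleared, what remains is the polynomial identity (c-a-b)(c+n) - (c-a)(c-b) =
  n(c+n) - (a+n)(b+n).\<close>

lemma hyp_term_telescope:
  assumes "c \<notin> \<int>\<^sub>\<le>\<^sub>0"
  shows "(c - a - b) * hyp_term a b c n - (c - a) * (c - b) / c * hyp_term a b (c + 1) n =
         of_nat n * hyp_term a b c n - of_nat (Suc n) * hyp_term a b c (Suc n)"
proof -
  have nz: "c \<noteq> 0" "c + of_nat n \<noteq> 0" "of_nat (Suc n) \<noteq> (0 :: complex)"
    using plus_of_nat_nonzero[OF assms] assms of_nat_neq_0 by auto
  have "(c - a - b) - (c - a) * (c - b) / (c + of_nat n) =
        of_nat n - (a + of_nat n) * (b + of_nat n) / (c + of_nat n)"
    using nz by (simp add: field_simps)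
  then have eq: "hyp_term a b c n * ((c - a - b) - (c - a) * (c - b) / (c + of_nat n)) =
        hyp_term a b c n * (of_nat n - (a + of_nat n) * (b + of_nat n) / (c + of_nat n))"
    by simp
  have shift: "(c - a) * (c - b) / c * hyp_term a b (c + 1) n =
        hyp_term a b c n * ((c - a) * (c - b) / (c + of_nat n))"
    unfolding hyp_term_shift[OF assms] using nz(1) by simp
  have step: "of_nat (Suc n) * hyp_term a b c (Suc n) =
        hyp_term a b c n * ((a + of_nat n) * (b + of_nat n) / (c + of_nat n))"
    unfolding hyp_term_Suc using nz(3) by (simp del: of_nat_Suc)
  show ?thesis
    by (simp only: shift step mult.commute[of _ "hyp_term a b c n"] right_diff_distrib[symmetric] eq)
qed

lemma suminf_hyp_term_contiguous:
  assumes "c \<notin> \<int>\<^sub>\<le>\<^sub>0" and "Re (c - a - b) > 0"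
  shows "suminf (hyp_term a b c) =
         (c - a) * (c - b) / (c * (c - a - b)) * suminf (hyp_term a b (c + 1))"
proof -
  have "summable (hyp_term a b c)" "summable (hyp_term a b (c + 1))"
    using assms plus_of_nat_not_nonpos_Ints[OF assms(1), of 1]
    by (auto intro!: summable_norm_cancel[OF summable_norm_hyp_term])
  then have "(\<lambda>n. (c - a - b) * hyp_term a b c n - (c - a) * (c - b) / c * hyp_term a b (c + 1) n)
      sums ((c - a - b) * suminf (hyp_term a b c) -
            (c - a) * (c - b) / c * suminf (hyp_term a b (c + 1)))"
    by (intro sums_diff sums_mult summable_sums)
  \<comment> \<open>Both ends of the telescoping sum vanish: the factor n is 0 at the start, and n
    times the term tends to 0.\<close>
  moreover have "(\<lambda>n. of_nat n * hyp_term a b c n - of_nat (Suc n) * hyp_term a b c (Suc n)) sums 0"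
    using telescope_sums'[OF of_nat_times_hyp_term_tendsto_0[OF assms]] by simp
  ultimately have "(c - a - b) * suminf (hyp_term a b c) =
      (c - a) * (c - b) / c * suminf (hyp_term a b (c + 1))"
    unfolding hyp_term_telescope[OF assms(1)] using sums_unique2 by fastforce
  moreover have "c - a - b \<noteq> 0"
    using assms(2) by auto
  ultimately have "suminf (hyp_term a b c) =
      (c - a) * (c - b) / c * suminf (hyp_term a b (c + 1)) / (c - a - b)"
    by (metis nonzero_mult_div_cancel_left)
  then show ?thesis
    by simp
qed

lemma suminf_hyp_term_shift:
  assumes "c \<notin> \<int>\<^sub>\<le>\<^sub>0" and "Re (c - a - b) > 0"
  shows "suminf (hyp_term a b c) =
         pochhammer (c - a) m * pochhammer (c - b) m / (pochhammer c m * pochhammer (c - a - b) m) *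
         suminf (hyp_term a b (c + of_nat m))"
proof (induction m)
  case (Suc m)
  have step: "suminf (hyp_term a b (c + of_nat m)) =
      (c - a + of_nat m) * (c - b + of_nat m) / ((c + of_nat m) * (c - a - b + of_nat m)) *
      suminf (hyp_term a b (c + of_nat (Suc m)))"
    using suminf_hyp_term_contiguous[of "c + of_nat m" a b] assms
      plus_of_nat_not_nonpos_Ints[of c m]
    by (simp add: diff_add_eq add.assoc add.commute[of 1 "of_nat m"])
  show ?case
    unfolding Suc.IH step pochhammer_rec'
    by (simp only: mult.assoc[symmetric] times_divide_times_eq) (simp only: mult_ac)
qed auto

section \<open>Limit as the lower parameter tends to infinity\<close>

lemma norm_hyp_term_antimono:
  assumes "Re c > 0"
  shows "norm (hyp_term a b (c + of_nat m) n) \<le> norm (hyp_term a b c n)"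
proof (induction n)
  case (Suc n)
  \<comment> \<open>In the right half-plane, adding m moves each denominator factor away from 0,
    while the numerators stay fixed. The bound is therefore uniform in m.\<close>
  have "norm (c + of_nat n) \<le> norm (c + of_nat m + of_nat n)"
    using assms by (auto simp: cmod_def intro!: power_mono)
  moreover have "norm (c + of_nat n) > 0"
    using assms by (auto simp: complex_eq_iff)
  ultimately show ?case
    unfolding hyp_term_Suc norm_mult norm_divide
    by (intro mult_mono divide_left_mono Suc.IH mult_right_mono mult_pos_pos)
      (auto simp del: of_nat_Suc)
qed auto

text \<open>Each passage from n to n + 1 contributes a factor 1/(c+m+n), which tends to 0, so only
  the initial term survives.\<close>

lemma hyp_term_shift_tendsto:
  "(\<lambda>m. hyp_term a b (c + of_nat m) n) \<longlonglongrightarrow> (if n = 0 then 1 else 0)"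
proof (induction n)
  case (Suc n)
  have "filterlim (\<lambda>m. (c + of_nat n) + of_nat m :: complex) at_infinity sequentially"
    by (intro tendsto_add_filterlim_at_infinity[OF tendsto_const] tendsto_of_nat)
  then have "(\<lambda>m. (a + of_nat n) * (b + of_nat n) / of_nat (Suc n) / ((c + of_nat n) + of_nat m))
      \<longlonglongrightarrow> 0"
    by (intro tendsto_divide_0[OF tendsto_const])
  from tendsto_mult[OF Suc.IH this] show ?case
    unfolding hyp_term_Suc by (simp add: mult_ac add_ac del: of_nat_Suc)
qed auto

lemma suminf_hyp_term_tendsto_1:
  assumes "c \<notin> \<int>\<^sub>\<le>\<^sub>0" and "Re (c - a - b) > 0"
  shows "(\<lambda>m. suminf (hyp_term a b (c + of_nat m))) \<longlonglongrightarrow> 1"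
proof -
  \<comment> \<open>The domination needs a lower parameter with positive real part. A preliminary
    shift by k provides it and does not change the limit in m.\<close>
  obtain k :: nat where k: "- Re c < real k"
    using reals_Archimedean2 by blast
  define d where "d = c + of_nat k"
  have lim: "(\<lambda>m. hyp_term a b (d + of_nat m) n) \<longlonglongrightarrow> (if n = 0 then 1 else 0)" for n
    by (rule hyp_term_shift_tendsto)
  have "Re d > 0"
    using k by (simp add: d_def)
  then have bound: "\<forall>\<^sub>F (n, m) in at_top \<times>\<^sub>F sequentially.
      norm (hyp_term a b (d + of_nat m) n) \<le> norm (hyp_term a b d n)"
    by (intro always_eventually) (simp add: norm_hyp_term_antimono)
  have summable: "summable (\<lambda>n. norm (hyp_term a b d n))"
    unfolding d_def using assms by (intro summable_norm_hyp_term plus_of_nat_not_nonpos_Ints) auto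
  have "(\<lambda>m. suminf (\<lambda>n. hyp_term a b (d + of_nat m) n))
      \<longlonglongrightarrow> (\<Sum>n. if n = 0 then 1 else 0)"
    using tannerys_theorem[OF lim bound summable sequentially_bot] by (elim conjE)
  also have "(\<Sum>n::nat. if n = 0 then 1 else 0) = (1 :: complex)"
    using sums_single[of 0 "\<lambda>_. 1 :: complex"] by (simp add: sums_iff)
  finally have "(\<lambda>m. suminf (hyp_term a b (c + of_nat (m + k)))) \<longlonglongrightarrow> 1"
    by (simp add: d_def add_ac)
  then show ?thesis
    by (rule LIMSEQ_offset)
qed

text \<open>Because (c-a) + (c-b) = c + (c-a-b), numerator and denominator share the factor
  \<open>K m\<close> made of factorials and powers of m. Its cancellation leaves a quotient of
  convergent \<open>rGamma_series\<close>.\<close>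

lemma pochhammer_quotient_tendsto:
  fixes a b c :: complex
  assumes "c \<notin> \<int>\<^sub>\<le>\<^sub>0" and "c - a - b \<notin> \<int>\<^sub>\<le>\<^sub>0"
  shows "(\<lambda>m. pochhammer (c - a) m * pochhammer (c - b) m /
            (pochhammer c m * pochhammer (c - a - b) m))
         \<longlonglongrightarrow> Gamma c * Gamma (c - a - b) * rGamma (c - a) * rGamma (c - b)"
proof (rule LIMSEQ_imp_Suc)
  define L where "L m = complex_of_real (ln (of_nat m))" for m
  define K where "K m = fact m * fact m * (exp (c * L m) * exp ((c - a - b) * L m))" for m
  have exp_eq: "exp ((c - a) * L m) * exp ((c - b) * L m) = exp (c * L m) * exp ((c - a - b) * L m)"
    for m
    by (simp add: algebra_simps flip: exp_add)
  have num: "pochhammer (c - a) (Suc m) * pochhammer (c - b) (Suc m) =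
      rGamma_series (c - a) m * rGamma_series (c - b) m * K m" for m
    unfolding pochhammer_conv_rGamma_series L_def[symmetric] K_def exp_eq[symmetric] by (simp only: mult_ac)
  have denom: "pochhammer c (Suc m) * pochhammer (c - a - b) (Suc m) =
      rGamma_series c m * rGamma_series (c - a - b) m * K m" for m
    unfolding pochhammer_conv_rGamma_series L_def[symmetric] K_def by (simp only: mult_ac)
  have K_nz: "K m \<noteq> 0" for m
    by (simp add: K_def)
  have "(\<lambda>m. rGamma_series (c - a) m * rGamma_series (c - b) m /
            (rGamma_series c m * rGamma_series (c - a - b) m))
        \<longlonglongrightarrow> rGamma (c - a) * rGamma (c - b) / (rGamma c * rGamma (c - a - b))"
    using assms by (intro tendsto_intros) (simp add: rGamma_eq_zero_iff)
  then show "(\<lambda>m. pochhammer (c - a) (Suc m) * pochhammer (c - b) (Suc m) /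
            (pochhammer c (Suc m) * pochhammer (c - a - b) (Suc m)))
         \<longlonglongrightarrow> Gamma c * Gamma (c - a - b) * rGamma (c - a) * rGamma (c - b)"
    unfolding num denom nonzero_mult_divide_mult_cancel_right[OF K_nz]
    by (simp add: Gamma_def divide_inverse mult_ac)
qed

theorem gauss_hypergeometric_sums:
  assumes "c \<notin> \<int>\<^sub>\<le>\<^sub>0" and "Re (c - a - b) > 0"
  shows "hyp_term a b c sums (Gamma c * Gamma (c - a - b) * rGamma (c - a) * rGamma (c - b))"
proof -
  \<comment> \<open>The convergence condition also keeps c-a-b away from the poles of Gamma.\<close>
  have "c - a - b \<notin> \<int>\<^sub>\<le>\<^sub>0"
    using assms(2) by (auto elim!: nonpos_Ints_cases simp: complex_eq_iff)
  from tendsto_mult[OF pochhammer_quotient_tendsto[OF assms(1) this]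
      suminf_hyp_term_tendsto_1[OF assms]]
  \<comment> \<open>The product of prefactor and shifted sum is the original sum for every m, so a
    constant sequence has the Gamma quotient as its limit.\<close>
  have "(\<lambda>m::nat. suminf (hyp_term a b c))
      \<longlonglongrightarrow> Gamma c * Gamma (c - a - b) * rGamma (c - a) * rGamma (c - b)"
    by (simp only: suminf_hyp_term_shift[OF assms, symmetric] mult_1_right)
  then have "suminf (hyp_term a b c) = Gamma c * Gamma (c - a - b) * rGamma (c - a) * rGamma (c - b)"
    by (simp add: LIMSEQ_const_iff)
  moreover have "summable (hyp_term a b c)"
    by (rule summable_norm_cancel[OF summable_norm_hyp_term[OF assms]])
  ultimately show ?thesis
    by (simp add: sums_iff)
qed

section \<open>The binomial series\<close>

lemma cos_minus_pi_of_nat: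
  "cos (x - of_real pi * of_nat k) = (-1) ^ k * cos (x :: complex)"
proof (induction k)
  case (Suc k)
  have "x - of_real pi * of_nat (Suc k) = (x - of_real pi * of_nat k) - of_real pi"
    by (simp add: algebra_simps)
  then have "cos (x - of_real pi * of_nat (Suc k)) = - cos (x - of_real pi * of_nat k)"
    by (simp only: cos_diff cos_of_real sin_of_real) simp
  with Suc.IH show ?case
    by simp
qed simp

text \<open>The quotient of the Pochhammer symbols of -z and 1 - z collapses to z/(z-k), and (-w)_k
  / k! is the binomial coefficient up to the sign (-1)^k.\<close>

lemma hyp_term_binomial:
  assumes "z \<notin> \<int>"
  shows "hyp_term (- w) (- z) (1 - z) k = (-1) ^ k * (w gchoose k) * (z / (z - of_nat k))"
proof -
  have "- z \<notin> \<int>\<^sub>\<le>\<^sub>0" "1 - z \<notin> \<int>\<^sub>\<le>\<^sub>0"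
    using assms nonpos_Ints_Int by (force simp: minus_in_Ints_iff)+
  then have nz: "pochhammer (1 - z) k \<noteq> 0"
    by (auto dest: pochhammer_eq_0_imp_nonpos_Int)
  have "z - of_nat k \<noteq> 0"
    using assms by auto
  moreover have "- z * pochhammer (1 - z) k = (of_nat k - z) * pochhammer (- z) k"
    using pochhammer_rec[of "- z" k] pochhammer_rec'[of "- z" k] by simp
  ultimately have "pochhammer (- z) k / pochhammer (1 - z) k = z / (z - of_nat k)"
    using nz by (simp add: field_simps)
  moreover have "hyp_term (- w) (- z) (1 - z) k =
      pochhammer (- w) k / fact k * (pochhammer (- z) k / pochhammer (1 - z) k)"
    by (simp add: hyp_term_def mult_ac)
  ultimately show ?thesis
    by (simp add: gbinomial_pochhammer)
qed

lemma cbinom_times_sin: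
  assumes "z \<notin> \<int>"
  shows "cbinom w z * (of_real pi * z) =
         Gamma (1 - z) * Gamma (w + 1) * rGamma (w - z + 1) * sin (of_real pi * z)"
proof -
  have z: "z \<notin> \<int>\<^sub>\<le>\<^sub>0"
    using assms nonpos_Ints_Int by blast
  \<comment> \<open>Abbreviating the sine hides its own pi from the rewriting with
    \<open>pi_eq\<close>.\<close>
  define S where "S = sin (of_real pi * z)"
  have "S \<noteq> 0"
    using assms by (auto simp: S_def sin_eq_0 mult.commute)
  then have pi_eq: "of_real pi = Gamma z * Gamma (1 - z) * S"
    using Gamma_reflection_complex[of z] by (simp add: S_def)
  have "cbinom w z * (of_real pi * z) =
      z * rGamma (z + 1) * Gamma z * (Gamma (1 - z) * Gamma (w + 1) * rGamma (w - z + 1) * S)"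
    unfolding cbinom_def pi_eq by (simp only: mult_ac)
  \<comment> \<open>The reflection formula brings in \<open>Gamma z\<close>, which cancels against z
    * rGamma (z+1) = rGamma z.\<close>
  moreover have "z * rGamma (z + 1) * Gamma z = 1"
    unfolding rGamma_plus1 using z by (simp add: rGamma_inverse_Gamma Gamma_eq_zero_iff)
  ultimately show ?thesis
    by (simp add: S_def)
qed

theorem mainTheorem6:
  fixes w z :: complex
  assumes "Re w > -1"
    and "z \<notin> \<int>"
  shows "summable (\<lambda>k::nat. norm (cbinom w (of_nat k) *
             (cos (of_real pi * z - of_real pi * of_nat k) / (of_real pi * z - of_real pi * of_nat k))))
    \<and> (\<Sum>k::nat. cbinom w (of_nat k) *
             (cos (of_real pi * z - of_real pi * of_nat k) / (of_real pi * z - of_real pi * of_nat k)))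
           = cbinom w z * cot (of_real pi * z)"
proof -
  \<comment> \<open>The part of each term independent of k: dividing z/(z-k) by pi z gives the
    required 1/(pi (z-k)), and the sign (-1)^k of the cosine is already in
    \<open>hyp_term_binomial\<close>.\<close>
  define C where "C = cos (of_real pi * z) / (of_real pi * z)"
  have z: "z \<noteq> 0" "1 - z \<notin> \<int>\<^sub>\<le>\<^sub>0"
    using assms(2) nonpos_Ints_Int[of "1 - z"] Ints_diff[of 1 "1 - z"] by auto
  \<comment> \<open>Here c-a-b = w + 1, so Re w > -1 is exactly the convergence condition in Gauss's
    theorem.\<close>
  have w: "w + 1 \<notin> \<int>\<^sub>\<le>\<^sub>0" "Re (1 - z - (- w) - (- z)) > 0"
    using assms(1) by (auto elim!: nonpos_Ints_cases simp: complex_eq_iff)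
  have term_eq: "cbinom w (of_nat k) *
      (cos (of_real pi * z - of_real pi * of_nat k) / (of_real pi * z - of_real pi * of_nat k)) =
      hyp_term (- w) (- z) (1 - z) k * C" for k
  proof -
    have "of_real pi * z - of_real pi * of_nat k = of_real pi * (z - of_nat k)"
      by (simp add: algebra_simps)
    moreover have "z - of_nat k \<noteq> 0"
      using assms(2) by auto
    ultimately show ?thesis
      unfolding cbinom_of_nat[OF w(1)] cos_minus_pi_of_nat hyp_term_binomial[OF assms(2)] C_def
      using z(1) by (simp add: divide_simps)
  qed
  have "sin (of_real pi * z) \<noteq> 0"
    using assms(2) by (auto simp: sin_eq_0 mult.commute)
  then have value_eq: "Gamma (1 - z) * Gamma (w + 1) * rGamma (w - z + 1) * C =
      cbinom w z * cot (of_real pi * z)"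
    using cbinom_times_sin[OF assms(2), of w] z(1)
    by (simp add: C_def cot_def field_simps)
  \<comment> \<open>Since c - b = 1, the last factor in Gauss's formula is \<open>rGamma 1\<close> =
    1.\<close>
  have "hyp_term (- w) (- z) (1 - z) sums (Gamma (1 - z) * Gamma (w + 1) * rGamma (w - z + 1))"
    using gauss_hypergeometric_sums[OF z(2) w(2)] by (simp add: algebra_simps)
  from sums_mult2[OF this, of C]
  have "(\<lambda>k. hyp_term (- w) (- z) (1 - z) k * C) sums (cbinom w z * cot (of_real pi * z))"
    by (simp only: value_eq)
  moreover have "summable (\<lambda>k. norm (hyp_term (- w) (- z) (1 - z) k * C))"
    unfolding norm_mult by (intro summable_mult2 summable_norm_hyp_term z w)
  ultimately show ?thesis
    unfolding term_eq by (simp add: sums_iff)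
qed

end
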